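(* Let $r,\gamma$ be positive real numbers and consider the continuous-time planar system $$\dot x = x(1-x)-xy,\qquad \dot y=\gamma xy-ry .$$ If $\gamma>r$, then the equilibrium point $E_2=\left(\frac{r}{\gamma},\,1-\frac{r}{\gamma}\right)$ of this system is globally asymptotically stable.
   Context: The system is a (rescaled) phytoplankton-zooplankton model, where $x$ is the phytoplankton density, $y$ is the zooplankton density, and the dot denotes the derivative with respect to time $t\ge 0$.
   Formalization: "Globally" is taken to mean for all initial states with x(0) > 0 and y(0) > 0; on the whole plane or the closed quadrant the claim fails, since the axes are invariant and contain the equilibria (0,0) and (1,0). *)

theory Defs
  imports "HOL-Analysis.Analysis"
begin

definition is_solution :: "('a::real_normed_vector \<Rightarrow> 'a) \<Rightarrow> (real \<Rightarrow> 'a) \<Rightarrow> bool" where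
  "is_solution f u \<longleftrightarrow> (\<forall>t\<ge>0. (u has_vector_derivative f (u t)) (at t within {0..}))"

definition equilibrium :: "('a::real_normed_vector \<Rightarrow> 'a) \<Rightarrow> 'a \<Rightarrow> bool" where
  "equilibrium f p \<longleftrightarrow> f p = 0"

definition forward_complete_on :: "('a::real_normed_vector \<Rightarrow> 'a) \<Rightarrow> 'a set \<Rightarrow> bool" where
  "forward_complete_on f D \<longleftrightarrow> (\<forall>q\<in>D. \<exists>u. is_solution f u \<and> u 0 = q)"

definition lyapunov_stable :: "('a::real_normed_vector \<Rightarrow> 'a) \<Rightarrow> 'a \<Rightarrow> bool" where
  "lyapunov_stable f p \<longleftrightarrow>
     (\<forall>\<epsilon>>0. \<exists>\<delta>>0. \<forall>u. is_solution f u \<longrightarrow> dist (u 0) p < \<delta> \<longrightarrow> (\<forall>t\<ge>0. dist (u t) p < \<epsilon>))"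

definition attractive_on :: "('a::real_normed_vector \<Rightarrow> 'a) \<Rightarrow> 'a set \<Rightarrow> 'a \<Rightarrow> bool" where
  "attractive_on f D p \<longleftrightarrow>
     (\<forall>u. is_solution f u \<longrightarrow> u 0 \<in> D \<longrightarrow> (u \<longlongrightarrow> p) at_top)"

text \<open>
  Global asymptotic stability is relative to a set \<open>D\<close> of admissible initial states.
  Because stability and attraction quantify over solutions on the whole half-line
  \<open>[0, \<infinity>)\<close>, completeness on \<open>D\<close> is part of the definition: it excludes that
  they hold vacuously because solutions blow up in finite time.
\<close>

definition globally_asymptotically_stable_on ::
    "('a::real_normed_vector \<Rightarrow> 'a) \<Rightarrow> 'a set \<Rightarrow> 'a \<Rightarrow> bool" where
  "globally_asymptotically_stable_on f D p \<longleftrightarrow>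
     open D \<and> p \<in> D \<and> equilibrium f p \<and> forward_complete_on f D \<and>
     lyapunov_stable f p \<and> attractive_on f D p"

definition plankton_field :: "real \<Rightarrow> real \<Rightarrow> real \<times> real \<Rightarrow> real \<times> real" where
  "plankton_field r \<gamma> = (\<lambda>(x, y). (x * (1 - x) - x * y, \<gamma> * x * y - r * y))"

text \<open>
  Both densities must be positive initially. The coordinate axes are invariant and contain
  the equilibria \<open>(0, 0)\<close> and \<open>(1, 0)\<close>, so no interior equilibrium attracts the
  closed quadrant.
\<close>

definition positive_quadrant :: "(real \<times> real) set" where
  "positive_quadrant = {(x, y). x > 0 \<and> y > 0}"

end

theory Submission
  imports Defs
begin

text \<open>
  Write \<open>(xs, ys)\<close> for the interior equilibrium and \<open>h s = s - 1 - ln s\<close>. The Lotka--Volterra function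
  \<open>V = \<gamma> xs h(x/xs) + ys h(y/ys)\<close> has orbital derivative \<open>- \<gamma> (x - xs)\<^sup>2\<close>, which gives
  stability and bounds every orbit away from the axes and from infinity. In logarithmic coordinates,
  truncating the exponentials above a bound for a sublevel set of \<open>V\<close> makes the field globally
  Lipschitz, so Banach's fixed point theorem gives a global solution; \<open>V\<close> keeps it where the
  truncation is inactive. For attraction, the perturbed function
  \<open>V + e (x - xs) (y - ys)\<close> with small \<open>e > 0\<close> decreases strictly away from the equilibrium on
  the orbit, so the orbit enters every neighbourhood of the equilibrium, and stability traps it there.
\<close>

section \<open>Global solutions of ODEs with a globally Lipschitz field\<close>

lemma antiderivative_half_line:
  fixes k :: "real \<Rightarrow> 'a::banach"
  assumes k: "continuous_on {0..} k" and t: "t \<ge> 0"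
  shows "((\<lambda>u. integral {0..u} k) has_vector_derivative k t) (at t within {0..})"
proof -
  have "((\<lambda>u. integral {0..u} k) has_vector_derivative k t) (at t within {0..t+1})"
    using t by (intro integral_has_vector_derivative continuous_on_subset[OF k]) auto
  moreover have "at t within {0..t+1} = at t within {0..}"
    using t by (intro at_within_nhd[where S="{..<t+1}"]) auto
  ultimately show ?thesis by simp
qed

text \<open>Integrating an exponential bound gains the factor \<open>1 / l\<close>, and the weight
  \<open>exp (- l * t)\<close> removes the growth. This one estimate gives both the boundedness of
  the fixed point operator and its contraction factor.\<close>

lemma norm_integral_le_exp:
  fixes k :: "real \<Rightarrow> 'a::banach"
  assumes k: "continuous_on {0..} k" and t: "t \<ge> 0" and l: "l > 0" and K: "K \<ge> 0"
    and bound: "\<And>s. s \<ge> 0 \<Longrightarrow> norm (k s) \<le> K * exp (l * s)"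
  shows "norm (exp (- l * t) *\<^sub>R integral {0..t} k) \<le> K / l"
proof -
  have "((\<lambda>s. K * exp (l * s)) has_integral K * exp (l * t) / l - K * exp (l * 0) / l) {0..t}"
    using t l by (intro fundamental_theorem_of_calculus)
      (auto intro!: derivative_eq_intros simp: has_real_derivative_iff_has_vector_derivative[symmetric])
  note int = has_integral_integrable[OF this] integral_unique[OF this]
  have "norm (integral {0..t} k) \<le> integral {0..t} (\<lambda>s. K * exp (l * s))"
    by (intro integral_norm_bound_integral int integrable_continuous_interval
        continuous_on_subset[OF k]) (auto intro: bound)
  also have "\<dots> \<le> K * exp (l * t) / l"
    unfolding int(2) using K l by simp
  finally have "exp (- l * t) * norm (integral {0..t} k) \<le> exp (- l * t) * (K * exp (l * t) / l)"
    by (rule mult_left_mono) simp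
  also have "\<dots> = K / l"
    by (simp add: exp_minus)
  finally show ?thesis by simp
qed

lemma global_solution_if_lipschitz:
  fixes F :: "'a::banach \<Rightarrow> 'a"
  assumes "L-lipschitz_on UNIV F"
  shows "\<exists>u. is_solution F u \<and> u 0 = q"
proof -
  \<comment> \<open>In \<open>v t = exp (- l * t) u t\<close> the integral operator contracts on the whole half-line at once.\<close>
  define l where "l = 2 * (L + 1)"
  have L: "L \<ge> 0" by (rule lipschitz_on_nonneg[OF assms])
  \<comment> \<open>\<open>L / l\<close> is the contraction factor of the operator below; the
    summand 1 in \<open>l\<close> keeps the divisor positive even for \<open>L = 0\<close>.\<close>
  then have l: "l > 0" "L / l \<le> 1 / 2" by (auto simp: l_def field_simps)
  have contF: "continuous_on UNIV F"
    by (rule lipschitz_on_continuous_on[OF assms])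
  define k where "k = (\<lambda>(v::real \<Rightarrow>\<^sub>C 'a) s. F (exp (l * s) *\<^sub>R v s))"
  have k: "continuous_on S (k v)" for v S
    unfolding k_def by (intro continuous_on_compose2[OF contF] continuous_intros) auto
  \<comment> \<open>The integral equation for \<open>u\<close>, rewritten for \<open>v\<close>.
    Elements of the type of bounded continuous functions live on the whole real line, so
    \<open>max 0 t\<close> extends the image by its value at 0 to negative times.\<close>
  define P where "P = (\<lambda>v t. exp (- l * max 0 t) *\<^sub>R (q + integral {0..max 0 t} (k v)))"
  have "P v \<in> bcontfun" for v
  proof -
    have "continuous_on {0..} (\<lambda>t. integral {0..t} (k v))"
      using antiderivative_half_line[OF k]
      by (meson atLeast_iff continuous_on_eq_continuous_within has_vector_derivative_continuous)
    then have "continuous_on UNIV (P v)"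
      unfolding P_def
      by (intro continuous_intros continuous_on_compose2[where s=UNIV and f="\<lambda>t. max 0 t"]) auto
    moreover have "norm (P v t) \<le> norm q + (norm (F 0) + L * norm v) / l" for t
    proof -
      have "norm (k v s) \<le> (norm (F 0) + L * norm v) * exp (l * s)" if "s \<ge> 0" for s
      proof -
        have "norm (k v s) \<le> norm (F 0) + norm (F (exp (l * s) *\<^sub>R v s) - F 0)"
          unfolding k_def by (rule norm_triangle_sub)
        also have "\<dots> \<le> norm (F 0) + L * (exp (l * s) * norm (v s))"
          using lipschitz_on_normD[OF assms, of "exp (l * s) *\<^sub>R v s" 0] by simp
        \<comment> \<open>Since \<open>exp (l * s) \<ge> 1\<close> for \<open>s \<ge> 0\<close>, the
          constant \<open>norm (F 0)\<close> is absorbed into the exponential bound.\<close>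
        also have "\<dots> \<le> norm (F 0) * exp (l * s) + L * (exp (l * s) * norm v)"
          using that l L
          by (intro add_mono mult_left_mono norm_bounded) (auto simp: mult_le_cancel_left1)
        finally show ?thesis by (simp add: algebra_simps)
      qed
      from norm_integral_le_exp[OF k _ l(1) _ this, of "max 0 t"] L
      have "norm (exp (- l * max 0 t) *\<^sub>R integral {0..max 0 t} (k v))
        \<le> (norm (F 0) + L * norm v) / l" by simp
      moreover have "norm (exp (- l * max 0 t) *\<^sub>R q) \<le> norm q"
        using l by (simp add: mult_left_le_one_le)
      ultimately show ?thesis
        unfolding P_def scaleR_add_right by (rule norm_triangle_mono[rotated])
    qed
    ultimately show ?thesis
      by (auto simp: bcontfun_def bounded_iff)
  qed
  then have P: "apply_bcontfun (Bcontfun (P v)) = P v" for v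
    by (simp add: Bcontfun_inverse)
  have "dist (Bcontfun (P v)) (Bcontfun (P w)) \<le> 1 / 2 * dist v w" for v w
  proof (rule dist_bound)
    fix t
    have "norm (k v s - k w s) \<le> (L * dist v w) * exp (l * s)" for s
    proof -
      have "norm (k v s - k w s) \<le> L * norm (exp (l * s) *\<^sub>R (v s - w s))"
        unfolding k_def
        using lipschitz_on_normD[OF assms, of "exp (l * s) *\<^sub>R v s" "exp (l * s) *\<^sub>R w s"]
        by (simp add: scaleR_diff_right)
      also have "\<dots> = (L * exp (l * s)) * dist (v s) (w s)"
        by (simp add: dist_norm)
      also have "\<dots> \<le> (L * exp (l * s)) * dist v w"
        using L by (intro mult_left_mono dist_bounded) auto
      finally show ?thesis by (simp add: algebra_simps)
    qed
    from norm_integral_le_exp[OF continuous_on_diff[OF k k] _ l(1) _ this, of "max 0 t"] L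
    have "norm (exp (- l * max 0 t) *\<^sub>R integral {0..max 0 t} (\<lambda>s. k v s - k w s))
      \<le> L * dist v w / l" by simp
    also have "\<dots> \<le> 1 / 2 * dist v w"
      using mult_right_mono[OF l(2), of "dist v w"] by simp
    finally show "dist (Bcontfun (P v) t) (Bcontfun (P w) t) \<le> 1 / 2 * dist v w"
      unfolding P unfolding P_def dist_norm scaleR_diff_right[symmetric]
      by (simp add: integral_diff integrable_continuous_interval k)
  qed
  with banach_fix_type[of "1/2" "\<lambda>v. Bcontfun (P v)"] obtain v where v: "Bcontfun (P v) = v"
    by auto
  define u where "u t = exp (l * t) *\<^sub>R v t" for t
  have u: "u t = q + integral {0..t} (k v)" if "t \<ge> 0" for t
  proof -
    have "u t = exp (l * t) *\<^sub>R P v t"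
      unfolding u_def using P[of v] by (simp add: v)
    then show ?thesis using that by (simp add: P_def exp_minus)
  qed
  have "is_solution F u"
    unfolding is_solution_def
  proof safe
    fix t :: real assume t: "t \<ge> 0"
    have "((\<lambda>t. q + integral {0..t} (k v)) has_vector_derivative k v t) (at t within {0..})"
      using has_vector_derivative_add[OF has_vector_derivative_const antiderivative_half_line[OF k t]]
      by simp
    then have "(u has_vector_derivative k v t) (at t within {0..})"
      by (rule has_vector_derivative_transform[rotated 2]) (use t u in auto)
    then show "(u has_vector_derivative F (u t)) (at t within {0..})"
      by (simp add: k_def u_def)
  qed
  moreover have "u 0 = q" using u[of 0] by simp
  ultimately show ?thesis by blast
qed

section \<open>Sign, monotonicity and time shift along solutions\<close>

text \<open>Integrating factor: \<open>x t * exp (- integral {0..t} k)\<close> has derivative zero,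
  hence is constant, so \<open>x\<close> keeps the sign of its initial value.\<close>

lemma linear_ode_pos:
  fixes x k :: "real \<Rightarrow> real"
  assumes x: "\<And>t. t \<ge> 0 \<Longrightarrow> (x has_real_derivative k t * x t) (at t within {0..})"
    and k: "continuous_on {0..} k" and "x 0 > 0" "t \<ge> 0"
  shows "x t > 0"
proof -
  define g where "g t = x t * exp (- integral {0..t} k)" for t
  have "(g has_real_derivative 0) (at s within {0..})" if "s \<ge> 0" for s
    unfolding g_def
    by (rule derivative_eq_intros x[OF that] refl that
        antiderivative_half_line[OF k that, folded has_real_derivative_iff_has_vector_derivative])+
      (simp add: algebra_simps)
  then have "\<exists>c. \<forall>s\<in>{0..}. g s = c"
    by (intro has_field_derivative_zero_constant) auto
  then have "g t = g 0" using \<open>t \<ge> 0\<close> by force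
  then have "g t > 0" using \<open>x 0 > 0\<close> by (simp add: g_def)
  then show ?thesis by (simp add: g_def zero_less_mult_iff)
qed

text \<open>The sign of the derivative is required only strictly before \<open>t\<close>, so that
  \<open>t\<close> may be the first time at which a level is reached.\<close>

lemma nonincreasing_on_interval:
  fixes f :: "real \<Rightarrow> real"
  assumes "\<And>t. t \<ge> 0 \<Longrightarrow> (f has_real_derivative f' t) (at t within {0..})"
    and "\<And>s. s \<ge> 0 \<Longrightarrow> s < t \<Longrightarrow> f' s \<le> 0" and "0 \<le> t"
  shows "f t \<le> f 0"
proof (rule DERIV_nonpos_imp_decreasing_open[where f=f and a=0 and b=t])
  show "\<exists>y. (f has_real_derivative y) (at s) \<and> y \<le> 0" if "0 < s" "s < t" for s
  proof -
    have "at s within {0..} = at s"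
      using that by (intro at_within_nhd[where S="{0<..}"]) auto
    then show ?thesis using assms(1)[of s] assms(2)[of s] that by auto
  qed
  have "continuous_on {0..} f"
    by (rule DERIV_continuous_on[OF assms(1)]) simp
  then show "continuous_on {0..t} f" by (rule continuous_on_subset) auto
qed fact

text \<open>The field is autonomous, so a solution may be restarted at time \<open>s\<close>. The
  chain rule needs the derivative of \<open>u\<close> only within the image \<open>{s..}\<close> of
  the half-line.\<close>

lemma is_solution_shift:
  assumes u: "is_solution f u" and "s \<ge> 0"
  shows "is_solution f (\<lambda>t. u (s + t))"
  unfolding is_solution_def
proof safe
  fix t :: real assume t: "t \<ge> 0"
  have "(u has_vector_derivative f (u (s + t))) (at (s + t) within (\<lambda>t. s + t) ` {0..})"
  proof (rule has_vector_derivative_within_subset)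
    show "(u has_vector_derivative f (u (s + t))) (at (s + t) within {0..})"
      using u \<open>s \<ge> 0\<close> t by (simp add: is_solution_def)
  qed (use \<open>s \<ge> 0\<close> in auto)
  moreover have "((\<lambda>t. s + t) has_vector_derivative 1) (at t within {0..})"
    using has_vector_derivative_add[OF has_vector_derivative_const has_vector_derivative_id] by simp
  ultimately show "((\<lambda>t. u (s + t)) has_vector_derivative f (u (s + t))) (at t within {0..})"
    using vector_diff_chain_within[of "\<lambda>t. s + t" 1 t "{0..}" u] by (simp add: o_def)
qed

section \<open>Estimates for \<open>h\<close>, the building block of the Lyapunov function\<close>

definition h :: "real \<Rightarrow> real" where
  "h s = s - 1 - ln s"

lemma h_nonneg: "s > 0 \<Longrightarrow> 0 \<le> h s"
  using ln_le_minus_one[of s] by (simp add: h_def)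

lemma h_deviation:
  assumes "s > 0"
  shows "\<bar>s - 1\<bar> \<le> h s + 2 * sqrt (h s)"
proof -
  \<comment> \<open>\<open>ln s = 2 ln (sqrt s) \<le> 2 (sqrt s - 1)\<close> gives \<open>(sqrt s - 1)\<^sup>2 \<le> h s\<close>.\<close>
  define d where "d = sqrt s - 1"
  have s: "s = (d + 1)\<^sup>2" "d > - 1" using assms by (auto simp: d_def)
  have "ln s = 2 * ln (d + 1)" using s by (simp add: ln_realpow)
  also have "\<dots> \<le> 2 * d" using ln_le_minus_one[of "d + 1"] s(2) by simp
  finally have "d\<^sup>2 \<le> h s" unfolding h_def s(1) by (simp add: power2_eq_square algebra_simps)
  moreover from this have "\<bar>d\<bar> \<le> sqrt (h s)" by (simp add: real_le_rsqrt)
  moreover have "\<bar>s - 1\<bar> \<le> d\<^sup>2 + 2 * \<bar>d\<bar>"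
  proof -
    have "s - 1 = d\<^sup>2 + 2 * d" unfolding s(1) by (simp add: power2_eq_square algebra_simps)
    then show ?thesis using zero_le_power2[of d] by linarith
  qed
  ultimately show ?thesis by linarith
qed

text \<open>Dropping the positive \<open>s\<close> from \<open>ln s = s - 1 - h s\<close> leaves a
  lower bound for \<open>ln s\<close>. It keeps points with bounded \<open>h\<close> away from
  0.\<close>

lemma exp_minus_h_le:
  assumes "s > 0"
  shows "exp (- h s - 1) \<le> s"
proof -
  have "- h s - 1 \<le> ln s" using assms by (simp add: h_def)
  then show ?thesis using assms by (simp add: ln_ge_iff)
qed

lemma h_small_imp_near_1:
  assumes "e > 0"
  obtains d where "d > 0" "\<And>s. s > 0 \<Longrightarrow> h s < d \<Longrightarrow> \<bar>s - 1\<bar> < e"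
proof -
  \<comment> \<open>With \<open>h s < d\<^sup>2\<close>, the bound of \<open>h_deviation\<close> is
    below \<open>d\<^sup>2 + 2 * d\<close>, which is at most \<open>3 * d\<close> because
    \<open>d \<le> 1\<close>.\<close>
  define d where "d = min 1 (e / 3)"
  have d: "0 < d" "d \<le> 1" "3 * d \<le> e" using assms by (auto simp: d_def)
  have "\<bar>s - 1\<bar> < e" if "s > 0" "h s < d\<^sup>2" for s
  proof -
    have "sqrt (h s) < d" using that(2) d by (simp add: real_less_lsqrt h_nonneg[OF that(1)])
    moreover have "d\<^sup>2 \<le> d" using d by (simp add: power2_eq_square mult_left_le)
    ultimately show ?thesis using h_deviation[OF that(1)] that(2) d by linarith
  qed
  then show thesis using that[of "d\<^sup>2"] d by simp
qed

section \<open>The Lotka-Volterra function of the system\<close>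

locale plankton =
  fixes r \<gamma> :: real
  assumes r: "0 < r" and r_less: "r < \<gamma>"
begin

definition xs where "xs = r / \<gamma>"
definition ys where "ys = 1 - r / \<gamma>"

lemma \<gamma>: "0 < \<gamma>" using r r_less by simp

lemma equilibrium_pos: "0 < xs" "0 < ys"
  using r r_less by (auto simp: xs_def ys_def)

lemma sum_eq_1: "xs + ys = 1"
  by (simp add: xs_def ys_def)

lemma growth_rates:
  "1 - x - y = - (x - xs) - (y - ys)" "\<gamma> * x - r = \<gamma> * (x - xs)"
  using \<gamma> by (simp_all add: xs_def ys_def right_diff_distrib)

definition V :: "real \<Rightarrow> real \<Rightarrow> real" where
  "V x y = \<gamma> * xs * h (x / xs) + ys * h (y / ys)"

lemma V_lower:
  assumes "x > 0" "y > 0"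
  shows "\<gamma> * xs * h (x / xs) \<le> V x y" "ys * h (y / ys) \<le> V x y" "0 \<le> V x y"
  using assms \<gamma> equilibrium_pos by (auto simp: V_def h_nonneg)

text \<open>The per-capita growth rates \<open>\<alpha>\<close> and \<open>\<beta>\<close> are left
  arbitrary, so that the formula serves both the truncated system and the original one.\<close>

lemma V_deriv:
  assumes "(x has_real_derivative x t * \<alpha>) (at t within S)" "x t > 0"
    and "(y has_real_derivative y t * \<beta>) (at t within S)" "y t > 0"
  shows "((\<lambda>t. V (x t) (y t)) has_real_derivative
    \<gamma> * (x t - xs) * \<alpha> + (y t - ys) * \<beta>) (at t within S)"
proof -
  have "((\<lambda>t. c * h (z t / c)) has_real_derivative (z t - c) * \<kappa>) (at t within S)"
    if "c > 0" "z t > 0" "(z has_real_derivative z t * \<kappa>) (at t within S)" for z c \<kappa>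
    unfolding h_def
    by (rule derivative_eq_intros that refl | use that in \<open>simp add: field_simps\<close>)+
  from DERIV_add[OF DERIV_cmult[OF this[OF equilibrium_pos(1) assms(2,1)], of \<gamma>]
      this[OF equilibrium_pos(2) assms(4,3)]]
  show ?thesis by (simp add: V_def mult.assoc)
qed

text \<open>The weight \<open>\<gamma>\<close> on the first summand of \<open>V\<close> is chosen so
  that the mixed terms in \<open>(x - xs) * (y - ys)\<close> cancel.\<close>

lemma orbital_derivative:
  "\<gamma> * (x - xs) * (1 - x - y) + (y - ys) * (\<gamma> * x - r) = - \<gamma> * (x - xs)\<^sup>2"
  unfolding growth_rates by (simp add: power2_eq_square algebra_simps)

text \<open>Both summands of \<open>V\<close> are nonnegative, so each alone is at most
  \<open>c\<close>. Then \<open>exp_minus_h_le\<close> bounds the coordinates from below and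
  \<open>h_deviation\<close> bounds them from above. Having \<open>1 \<le> M\<close> makes
  \<open>M\<close> exceed \<open>xs\<close> and \<open>ys\<close> as well.\<close>

lemma V_sublevel_bounds:
  obtains m M where "0 < m" "1 \<le> M"
    "\<And>x y. x > 0 \<Longrightarrow> y > 0 \<Longrightarrow> V x y \<le> c \<Longrightarrow> m \<le> x \<and> m \<le> y \<and> x \<le> M \<and> y \<le> M"
proof -
  \<comment> \<open>One estimate for both coordinates: \<open>k\<close> is the weight of the
    summand, namely \<open>\<gamma>\<close> for \<open>x\<close> and 1 for \<open>y\<close>, and
    \<open>z\<close> is the equilibrium value.\<close>
  have *: "z * exp (- (c / (k * z)) - 1) \<le> s \<and> s \<le> z * (1 + c / (k * z) + 2 * sqrt (c / (k * z)))"
    if "k > 0" "z > 0" "s > 0" "k * z * h (s / z) \<le> c" for s z k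
  proof -
    have hc: "h (s / z) \<le> c / (k * z)"
      using that by (simp add: pos_le_divide_eq mult.commute)
    have sz: "s / z > 0" using that by simp
    have "exp (- (c / (k * z)) - 1) \<le> exp (- h (s / z) - 1)" using hc by simp
    also have "\<dots> \<le> s / z" by (rule exp_minus_h_le[OF sz])
    finally have 1: "z * exp (- (c / (k * z)) - 1) \<le> s"
      using that by (simp add: pos_le_divide_eq mult.commute)
    have "s / z \<le> 1 + h (s / z) + 2 * sqrt (h (s / z))"
      using h_deviation[OF sz] by linarith
    also have "\<dots> \<le> 1 + c / (k * z) + 2 * sqrt (c / (k * z))"
      using hc by (intro add_mono mult_left_mono real_sqrt_le_mono) auto
    finally show ?thesis
      using 1 that by (simp add: pos_divide_le_eq mult.commute)
  qed
  define m where "m = (\<lambda>k z. z * exp (- (c / (k * z)) - 1))"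
  define M where "M = (\<lambda>k z. z * (1 + c / (k * z) + 2 * sqrt (c / (k * z))))"
  show thesis
  proof (rule that)
    show "0 < min (m \<gamma> xs) (m 1 ys)"
      using equilibrium_pos by (simp add: m_def)
    show "1 \<le> max 1 (max (M \<gamma> xs) (M 1 ys))" by simp
    fix x y :: real assume xy: "x > 0" "y > 0" "V x y \<le> c"
    have "\<gamma> * xs * h (x / xs) \<le> c" "1 * ys * h (y / ys) \<le> c"
      using V_lower[OF xy(1,2)] xy(3) by auto
    from *[OF \<gamma> equilibrium_pos(1) xy(1) this(1)] *[OF zero_less_one equilibrium_pos(2) xy(2) this(2)]
    show "min (m \<gamma> xs) (m 1 ys) \<le> x \<and> min (m \<gamma> xs) (m 1 ys) \<le> y \<and>
      x \<le> max 1 (max (M \<gamma> xs) (M 1 ys)) \<and> y \<le> max 1 (max (M \<gamma> xs) (M 1 ys))"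
      unfolding m_def M_def by (auto simp: min_le_iff_disj le_max_iff_disj)
  qed
qed

section \<open>Existence and positivity of solutions of the plankton system\<close>

lemma solution_iff:
  "is_solution (plankton_field r \<gamma>) u \<longleftrightarrow>
    (\<forall>t\<ge>0. ((\<lambda>t. fst (u t)) has_real_derivative fst (u t) * (1 - fst (u t) - snd (u t))) (at t within {0..}) \<and>
       ((\<lambda>t. snd (u t)) has_real_derivative snd (u t) * (\<gamma> * fst (u t) - r)) (at t within {0..}))"
proof -
  have "(u has_vector_derivative plankton_field r \<gamma> (u t)) (at t within {0..}) \<longleftrightarrow>
    ((\<lambda>t. fst (u t)) has_real_derivative fst (u t) * (1 - fst (u t) - snd (u t))) (at t within {0..}) \<and>
    ((\<lambda>t. snd (u t)) has_real_derivative snd (u t) * (\<gamma> * fst (u t) - r)) (at t within {0..})" for t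
  proof -
    define a where "a = fst (u t) * (1 - fst (u t) - snd (u t))"
    define b where "b = snd (u t) * (\<gamma> * fst (u t) - r)"
    have "plankton_field r \<gamma> (u t) = (a, b)"
      by (simp add: plankton_field_def a_def b_def split_def algebra_simps)
    moreover have "(u has_vector_derivative (a, b)) (at t within {0..}) \<longleftrightarrow>
      ((\<lambda>t. fst (u t)) has_vector_derivative a) (at t within {0..}) \<and> ((\<lambda>t. snd (u t)) has_vector_derivative b) (at t within {0..})"
      using bounded_linear.has_vector_derivative[OF bounded_linear_fst, of u "(a, b)" "at t within {0..}"]
        bounded_linear.has_vector_derivative[OF bounded_linear_snd, of u "(a, b)" "at t within {0..}"]
        has_vector_derivative_Pair[of "\<lambda>t. fst (u t)" a t "{0..}" "\<lambda>t. snd (u t)" b]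
      by auto
    ultimately show ?thesis
      by (simp add: a_def b_def has_real_derivative_iff_has_vector_derivative)
  qed
  then show ?thesis by (simp add: is_solution_def)
qed

lemma has_global_solution:
  assumes q: "q \<in> positive_quadrant"
  shows "\<exists>u. is_solution (plankton_field r \<gamma>) u \<and> u 0 = q"
proof -
  obtain x0 y0 where q_eq: "q = (x0, y0)" and pos: "x0 > 0" "y0 > 0"
    using q by (auto simp: positive_quadrant_def)
  \<comment> \<open>The summand 1 makes the orbit start strictly below the level \<open>c\<close>,
    which the first-exit argument below contradicts.\<close>
  define c where "c = V x0 y0 + 1"
  obtain m M where M: "1 \<le> M"
    "\<And>x y. x > 0 \<Longrightarrow> y > 0 \<Longrightarrow> V x y \<le> c \<Longrightarrow> m \<le> x \<and> m \<le> y \<and> x \<le> M \<and> y \<le> M"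
    using V_sublevel_bounds[of c] by metis
  define E where "E a = exp (min a (ln M))" for a :: real
  have E_eq: "E a = exp a" if "exp a \<le> M" for a
    using that M(1) by (simp add: E_def min_def ln_ge_iff)
  \<comment> \<open>Below \<open>ln M\<close> the exponential has slope at most \<open>M\<close>;
    the inequality \<open>1 - exp (- s) \<le> s\<close> replaces the mean value theorem.\<close>
  have E_less: "exp a' - exp a \<le> M * (a' - a)" if "a \<le> a'" "a' \<le> ln M" for a a'
  proof -
    have "exp a' - exp a = exp a' * (1 - exp (a - a'))"
      by (simp add: exp_diff algebra_simps)
    also have "\<dots> \<le> exp a' * (a' - a)"
    proof (rule mult_left_mono)
      show "1 - exp (a - a') \<le> a' - a" using exp_ge_add_one_self[of "a - a'"] by linarith
    qed simp
    also have "\<dots> \<le> M * (a' - a)"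
    proof (rule mult_right_mono)
      show "exp a' \<le> M" using that M(1) by (simp add: ln_ge_iff)
    qed (use that in simp)
    finally show ?thesis .
  qed
  have E_lip: "\<bar>E a - E a'\<bar> \<le> M * \<bar>a - a'\<bar>" for a a'
  proof -
    have "\<bar>E a - E a'\<bar> \<le> M * \<bar>min a (ln M) - min a' (ln M)\<bar>"
      using E_less[of "min a (ln M)" "min a' (ln M)"] E_less[of "min a' (ln M)" "min a (ln M)"]
      by (cases "a \<le> a'") (auto simp: E_def abs_if min_def)
    also have "\<dots> \<le> M * \<bar>a - a'\<bar>"
      using M(1) by (intro mult_left_mono) auto
    finally show ?thesis .
  qed
  \<comment> \<open>The per-capita growth rates are the field for \<open>(ln x, ln y)\<close>, here
    with truncated exponentials.\<close>
  define F where "F = (\<lambda>(a, b). (1 - E a - E b, \<gamma> * E a - r))"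
  \<comment> \<open>The 2 counts the two truncated exponentials in the first component, and
    \<open>\<gamma>\<close> comes from the second.\<close>
  have "((2 + \<gamma>) * M)-lipschitz_on UNIV F"
  proof (rule lipschitz_onI)
    fix p p' :: "real \<times> real"
    obtain a b a' b' where p: "p = (a, b)" "p' = (a', b')" by fastforce
    have "\<bar>E a - E a'\<bar> \<le> M * dist p p'" "\<bar>E b - E b'\<bar> \<le> M * dist p p'"
      using order.trans[OF E_lip[of a a'] mult_left_mono[of "\<bar>a - a'\<bar>" "dist p p'" M]]
        order.trans[OF E_lip[of b b'] mult_left_mono[of "\<bar>b - b'\<bar>" "dist p p'" M]]
        M(1) dist_fst_le[of p p'] dist_snd_le[of p p']
      by (auto simp: p dist_real_def)
    moreover from this(1) have "\<bar>\<gamma> * E a - \<gamma> * E a'\<bar> \<le> \<gamma> * (M * dist p p')"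
      using \<gamma> by (simp add: abs_mult flip: right_diff_distrib)
    moreover have "dist (F p) (F p') \<le> \<bar>(1 - E a - E b) - (1 - E a' - E b')\<bar> + \<bar>\<gamma> * E a - \<gamma> * E a'\<bar>"
      unfolding p F_def by (simp add: dist_Pair_Pair dist_real_def sqrt_sum_squares_le_sum_abs order.trans[OF sqrt_sum_squares_le_sum_abs])
    ultimately show "dist (F p) (F p') \<le> (2 + \<gamma>) * M * dist p p'"
      by (simp add: algebra_simps)
  qed (use \<gamma> M in simp)
  from global_solution_if_lipschitz[OF this, of "(ln x0, ln y0)"]
  obtain w where w: "is_solution F w" "w 0 = (ln x0, ln y0)" by blast
  define x where "x t = exp (fst (w t))" for t
  define y where "y t = exp (snd (w t))" for t
  have w': "((\<lambda>t. fst (w t)) has_real_derivative 1 - E (fst (w t)) - E (snd (w t))) (at t within {0..})"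
    "((\<lambda>t. snd (w t)) has_real_derivative \<gamma> * E (fst (w t)) - r) (at t within {0..})"
    if "t \<ge> 0" for t
  proof -
    have *: "(w has_vector_derivative F (w t)) (at t within {0..})"
      using w(1) that by (simp add: is_solution_def)
    from bounded_linear.has_vector_derivative[OF bounded_linear_fst *]
      bounded_linear.has_vector_derivative[OF bounded_linear_snd *]
    show "((\<lambda>t. fst (w t)) has_real_derivative 1 - E (fst (w t)) - E (snd (w t))) (at t within {0..})"
      "((\<lambda>t. snd (w t)) has_real_derivative \<gamma> * E (fst (w t)) - r) (at t within {0..})"
      by (simp_all add: F_def split_def has_real_derivative_iff_has_vector_derivative)
  qed
  have x': "(x has_real_derivative x t * (1 - E (fst (w t)) - E (snd (w t)))) (at t within {0..})"
    and y': "(y has_real_derivative y t * (\<gamma> * E (fst (w t)) - r)) (at t within {0..})"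
    if "t \<ge> 0" for t
    unfolding x_def y_def by (rule derivative_eq_intros w'[OF that] refl)+
  have xy_pos: "x t > 0" "y t > 0" for t by (simp_all add: x_def y_def)
  define v where "v t = V (x t) (y t)" for t
  have v': "(v has_real_derivative \<gamma> * (x t - xs) * (1 - E (fst (w t)) - E (snd (w t))) +
      (y t - ys) * (\<gamma> * E (fst (w t)) - r)) (at t within {0..})" if "t \<ge> 0" for t
    unfolding v_def by (rule V_deriv[OF x'[OF that] xy_pos(1) y'[OF that] xy_pos(2)])
  have inactive: "E (fst (w t)) = x t" "E (snd (w t)) = y t" if "v t \<le> c" for t
    using M(2)[OF xy_pos, of t t] that E_eq unfolding v_def x_def y_def by auto
  \<comment> \<open>First-exit argument: let \<open>s\<close> be the first time with
    \<open>c \<le> v s\<close>. Before \<open>s\<close> the truncation is inactive and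
    \<open>v\<close> decreases weakly, so \<open>v s \<le> v 0 < c\<close>.\<close>
  have v_less: "v t \<le> c" if "t \<ge> 0" for t
  proof (rule ccontr)
    assume "\<not> v t \<le> c"
    have cont: "continuous_on {0..t} v"
      by (rule continuous_on_subset[OF DERIV_continuous_on[OF v']]) auto
    define S where "S = {s \<in> {0..t}. c \<le> v s}"
    have "S = {0..t} \<inter> v -` {c..}" by (auto simp: S_def)
    then have "closed S" using continuous_closed_preimage[OF cont] by auto
    moreover have "bounded S" by (rule bounded_subset[of "{0..t}"]) (auto simp: S_def)
    moreover have "t \<in> S" using that \<open>\<not> v t \<le> c\<close> by (simp add: S_def)
    ultimately obtain s where s: "s \<in> S" "\<And>s'. s' \<in> S \<Longrightarrow> s \<le> s'"
      using compact_attains_inf[of S] by (auto simp: compact_eq_bounded_closed)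
    have "v s \<le> v 0"
    proof (rule nonincreasing_on_interval[OF v'])
      fix \<tau> assume \<tau>: "\<tau> \<ge> 0" "\<tau> < s"
      then have "v \<tau> \<le> c" using s by (force simp: S_def)
      then have "\<gamma> * (x \<tau> - xs) * (1 - E (fst (w \<tau>)) - E (snd (w \<tau>))) +
        (y \<tau> - ys) * (\<gamma> * E (fst (w \<tau>)) - r) = - \<gamma> * (x \<tau> - xs)\<^sup>2"
        unfolding inactive[OF \<open>v \<tau> \<le> c\<close>] by (simp only: orbital_derivative)
      then show "\<gamma> * (x \<tau> - xs) * (1 - E (fst (w \<tau>)) - E (snd (w \<tau>))) +
        (y \<tau> - ys) * (\<gamma> * E (fst (w \<tau>)) - r) \<le> 0"
        using \<gamma> by simp
    qed (use s in \<open>auto simp: S_def\<close>)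
    moreover have "v 0 < c" using pos by (simp add: v_def x_def y_def w(2) c_def)
    ultimately show False using s by (simp add: S_def)
  qed
  have "is_solution (plankton_field r \<gamma>) (\<lambda>t. (x t, y t))"
    unfolding solution_iff using x' y' by (simp add: inactive[OF v_less])
  moreover have "(x 0, y 0) = q" using pos by (simp add: x_def y_def w(2) q_eq)
  ultimately show ?thesis by (metis (no_types, lifting))
qed

text \<open>Along a given solution, each equation is linear in its own component with a continuous
  coefficient, so \<open>linear_ode_pos\<close> applies to each separately.\<close>

lemma solution_pos:
  assumes u: "is_solution (plankton_field r \<gamma>) u" and u0: "u 0 \<in> positive_quadrant" and t: "t \<ge> 0"
  shows "fst (u t) > 0" "snd (u t) > 0"
proof -
  have cont: "continuous_on {0..} (\<lambda>t. fst (u t))" "continuous_on {0..} (\<lambda>t. snd (u t))"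
    using u unfolding solution_iff by (auto intro: DERIV_continuous_on)
  have pos: "fst (u 0) > 0" "snd (u 0) > 0"
    using u0 by (auto simp: positive_quadrant_def)
  show "fst (u t) > 0"
    by (rule linear_ode_pos[where k="\<lambda>t. 1 - fst (u t) - snd (u t)"])
      (use u t pos in \<open>auto intro!: continuous_intros cont simp: solution_iff mult.commute\<close>)
  show "snd (u t) > 0"
    by (rule linear_ode_pos[where k="\<lambda>t. \<gamma> * fst (u t) - r"])
      (use u t pos in \<open>auto intro!: continuous_intros cont simp: solution_iff mult.commute\<close>)
qed

lemma V_deriv_solution:
  assumes u: "is_solution (plankton_field r \<gamma>) u" and u0: "u 0 \<in> positive_quadrant" and t: "t \<ge> 0"
  shows "((\<lambda>t. V (fst (u t)) (snd (u t))) has_real_derivative - \<gamma> * (fst (u t) - xs)\<^sup>2) (at t within {0..})"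
proof -
  define x y where "x = fst (u t)" and "y = snd (u t)"
  show ?thesis
    using orbital_derivative[of x y] V_deriv[of "\<lambda>t. fst (u t)" t "1 - x - y" "{0..}" "\<lambda>t. snd (u t)" "\<gamma> * x - r"]
      solution_pos[OF assms] u t unfolding solution_iff x_def y_def by auto
qed

lemma V_solution_le:
  assumes u: "is_solution (plankton_field r \<gamma>) u" and u0: "u 0 \<in> positive_quadrant" and t: "t \<ge> 0"
  shows "V (fst (u t)) (snd (u t)) \<le> V (fst (u 0)) (snd (u 0))"
  by (rule nonincreasing_on_interval[OF V_deriv_solution[OF u u0] _ t]) (use \<gamma> in auto)

lemma open_positive_quadrant: "open positive_quadrant"
proof -
  have "positive_quadrant = {0<..} \<times> {0<..}" by (auto simp: positive_quadrant_def)
  then show ?thesis by (metis open_Times open_greaterThan)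
qed

lemma equilibrium_in_quadrant: "(xs, ys) \<in> positive_quadrant"
  using equilibrium_pos by (simp add: positive_quadrant_def)

section \<open>Stability and attraction\<close>

lemma stable: "lyapunov_stable (plankton_field r \<gamma>) (xs, ys)"
  unfolding lyapunov_stable_def
proof safe
  fix e :: real assume "e > 0"
  then obtain d where d: "d > 0" "\<And>s. s > 0 \<Longrightarrow> h s < d \<Longrightarrow> \<bar>s - 1\<bar> < e / 2"
    using h_small_imp_near_1[of "e / 2"] by auto
  \<comment> \<open>Each summand of \<open>V\<close> is at most \<open>V\<close>, so
    \<open>V x y < c\<close> forces both values of \<open>h\<close> below \<open>d\<close>.\<close>
  define c where "c = min (\<gamma> * xs * d) (ys * d)"
  have c: "c > 0" using d \<gamma> equilibrium_pos by (simp add: c_def)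
  have near: "dist (x, y) (xs, ys) < e" if "x > 0" "y > 0" "V x y < c" for x y
  proof -
    \<comment> \<open>Both equilibrium coordinates are at most 1, so the absolute deviation is at
      most the relative one, which \<open>h\<close> controls.\<close>
    have *: "\<bar>s - z\<bar> < e / 2" if "s > 0" "z > 0" "z \<le> 1" "h (s / z) < d" for s z
    proof -
      have "\<bar>s - z\<bar> = z * \<bar>s / z - 1\<bar>" using that by (simp add: abs_if field_simps)
      also have "\<dots> \<le> \<bar>s / z - 1\<bar>" using that by (intro mult_left_le_one_le) auto
      also have "\<dots> < e / 2" using d(2)[of "s / z"] that by simp
      finally show ?thesis .
    qed
    have "\<gamma> * xs * h (x / xs) < \<gamma> * xs * d" "ys * h (y / ys) < ys * d"
      using V_lower[OF that(1,2)] that(3) by (auto simp: c_def)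
    then have "h (x / xs) < d" "h (y / ys) < d"
      using \<gamma> equilibrium_pos by (auto simp: mult_less_cancel_left_pos)
    then have "\<bar>x - xs\<bar> < e / 2" "\<bar>y - ys\<bar> < e / 2"
      using *[of x xs] *[of y ys] that equilibrium_pos sum_eq_1 by auto
    moreover have "dist (x, y) (xs, ys) \<le> \<bar>x - xs\<bar> + \<bar>y - ys\<bar>"
      by (simp add: dist_Pair_Pair dist_real_def order.trans[OF sqrt_sum_squares_le_sum_abs])
    ultimately show ?thesis by linarith
  qed
  have "isCont (\<lambda>q. V (fst q) (snd q)) (xs, ys)"
    unfolding V_def h_def using equilibrium_pos by (intro continuous_intros) auto
  moreover have "V xs ys = 0" using equilibrium_pos by (simp add: V_def h_def)
  ultimately have "((\<lambda>q. V (fst q) (snd q)) \<longlongrightarrow> 0) (nhds (xs, ys))"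
    using tendsto_at_iff_tendsto_nhds[of "\<lambda>q. V (fst q) (snd q)" "(xs, ys)"] by (simp add: isCont_def)
  from order_tendstoD(2)[OF this c]
  \<comment> \<open>\<open>lyapunov_stable\<close> puts no positivity condition on initial states,
    so the neighbourhood must also lie in the open quadrant, where the estimates for
    \<open>V\<close> hold.\<close>
  have "\<forall>\<^sub>F q in nhds (xs, ys). V (fst q) (snd q) < c \<and> q \<in> positive_quadrant"
    using eventually_nhds_in_open[OF open_positive_quadrant equilibrium_in_quadrant]
    by (rule eventually_conj)
  then obtain \<delta> where \<delta>: "\<delta> > 0"
    "\<And>q. dist q (xs, ys) < \<delta> \<Longrightarrow> V (fst q) (snd q) < c \<and> q \<in> positive_quadrant"
    unfolding eventually_nhds_metric by blast
  show "\<exists>\<delta>>0. \<forall>u. is_solution (plankton_field r \<gamma>) u \<longrightarrow> dist (u 0) (xs, ys) < \<delta> \<longrightarrow>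
    (\<forall>t\<ge>0. dist (u t) (xs, ys) < e)"
  proof (intro exI[of _ \<delta>] conjI allI impI \<delta>(1))
    fix u t assume u: "is_solution (plankton_field r \<gamma>) u" "dist (u 0) (xs, ys) < \<delta>" and t: "0 \<le> (t::real)"
    from \<delta>(2)[OF u(2)] have u0: "u 0 \<in> positive_quadrant" "V (fst (u 0)) (snd (u 0)) < c" by auto
    show "dist (u t) (xs, ys) < e"
      using near[OF solution_pos[OF u(1) u0(1) t]] V_solution_le[OF u(1) u0(1) t] u0(2) by simp
  qed
qed

text \<open>The orbital derivative of \<open>V\<close> vanishes on the whole line
  \<open>x = xs\<close>, so \<open>V\<close> alone gives no rate of decrease. The derivative of
  \<open>(x - xs) * (y - ys)\<close> contributes \<open>- x * (y - ys)\<^sup>2\<close>, which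
  supplies the missing direction. An orbit staying outside the ball would then push a function
  bounded below down at a fixed rate forever.\<close>

lemma enters_every_ball:
  assumes u: "is_solution (plankton_field r \<gamma>) u" and u0: "u 0 \<in> positive_quadrant" and "d > 0"
  shows "\<exists>t\<ge>0. dist (u t) (xs, ys) < d"
proof (rule ccontr)
  assume far: "\<not> ?thesis"
  define x y where "x t = fst (u t)" and "y t = snd (u t)" for t
  define v where "v t = V (x t) (y t)" for t
  note pos = solution_pos[OF u u0, folded x_def y_def]
  obtain m M where m: "0 < m" "1 \<le> M"
    "\<And>x y. x > 0 \<Longrightarrow> y > 0 \<Longrightarrow> V x y \<le> v 0 \<Longrightarrow> m \<le> x \<and> m \<le> y \<and> x \<le> M \<and> y \<le> M"
    using V_sublevel_bounds[of "v 0"] by metis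
  have bounds: "m \<le> x t" "x t \<le> M" "y t \<le> M" if "t \<ge> 0" for t
    using m(3)[OF pos[OF that]] V_solution_le[OF u u0 that] by (auto simp: v_def x_def y_def)
  define X Y where "X t = x t - xs" and "Y t = y t - ys" for t
  \<comment> \<open>\<open>C\<close> collects the \<open>(X t)\<^sup>2\<close> coefficients produced
    by the perturbation: the first from splitting the mixed term, the second from
    \<open>\<gamma> * y t \<le> \<gamma> * M\<close>.\<close>
  define C where "C = M\<^sup>2 / (2 * m) + \<gamma> * M"
  have C: "C > 0" using m \<gamma> by (simp add: C_def add_nonneg_pos)
  \<comment> \<open>With \<open>e * C = \<gamma> / 2\<close>, the perturbation consumes at most half
    of the decrease in the \<open>X\<close> direction.\<close>
  define e where "e = \<gamma> / (2 * C)"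
  have e: "e > 0" "e * C = \<gamma> / 2" using C \<gamma> by (auto simp: e_def)
  \<comment> \<open>\<open>\<kappa>\<close> is the smaller of the two remaining decrease
    coefficients, those of \<open>(X t)\<^sup>2\<close> and \<open>(Y t)\<^sup>2\<close>.\<close>
  define \<kappa> where "\<kappa> = min (\<gamma> / 2) (e * m / 2)"
  have \<kappa>: "\<kappa> > 0" "\<kappa> \<le> \<gamma> / 2" "\<kappa> \<le> e * m / 2" using \<gamma> e m by (auto simp: \<kappa>_def)
  \<comment> \<open>The term \<open>\<kappa> d\<^sup>2 t\<close> absorbs the decrease rate outside the ball, so \<open>W\<close> is still nonincreasing.\<close>
  define W where "W t = v t + e * (X t * Y t) + \<kappa> * d\<^sup>2 * t" for t
  define W' where "W' t = - \<gamma> * (X t)\<^sup>2 +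
    e * (- x t * X t * Y t - x t * (Y t)\<^sup>2 + \<gamma> * y t * (X t)\<^sup>2) + \<kappa> * d\<^sup>2" for t
  have W': "(W has_real_derivative W' t) (at t within {0..})" if t: "t \<ge> 0" for t
  proof -
    have v': "(v has_real_derivative - \<gamma> * (X t)\<^sup>2) (at t within {0..})"
      using V_deriv_solution[OF u u0 t] by (simp add: v_def[abs_def] X_def x_def y_def)
    have x': "(x has_real_derivative x t * (1 - x t - y t)) (at t within {0..})"
      and y': "(y has_real_derivative y t * (\<gamma> * x t - r)) (at t within {0..})"
      using u t by (simp_all add: solution_iff x_def[abs_def] y_def[abs_def])
    have eq: "1 - x t - y t = - X t - Y t" "\<gamma> * x t - r = \<gamma> * X t"
      unfolding X_def Y_def by (rule growth_rates)+
    have X': "(X has_real_derivative x t * (- X t - Y t)) (at t within {0..})"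
      and Y': "(Y has_real_derivative y t * (\<gamma> * X t)) (at t within {0..})"
      unfolding X_def[abs_def] Y_def[abs_def]
      by (rule derivative_eq_intros x' y' refl | simp add: eq[unfolded X_def Y_def])+
    show ?thesis
      unfolding W_def[abs_def] W'_def
      by (rule derivative_eq_intros v' X' Y' refl)+ (simp add: power2_eq_square algebra_simps)
  qed
  have W'_le: "W' t \<le> 0" if t: "t \<ge> 0" for t
  proof -
    note b = bounds[OF t]
    have "- x t * X t * Y t \<le> M * \<bar>X t\<bar> * \<bar>Y t\<bar>"
    proof -
      have "- x t * X t * Y t \<le> \<bar>x t\<bar> * \<bar>X t\<bar> * \<bar>Y t\<bar>"
        by (metis abs_ge_self abs_minus_cancel abs_mult)
      also have "\<dots> \<le> M * \<bar>X t\<bar> * \<bar>Y t\<bar>"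
        using b m by (intro mult_right_mono) auto
      finally show ?thesis .
    qed
    also have "\<dots> \<le> M\<^sup>2 / (2 * m) * (X t)\<^sup>2 + m / 2 * (Y t)\<^sup>2"
    proof -
      \<comment> \<open>Weighted so that the mixed term costs only \<open>m / 2\<close> of the
        available \<open>m * (Y t)\<^sup>2\<close>.\<close>
      have "0 \<le> (M * \<bar>X t\<bar> - m * \<bar>Y t\<bar>)\<^sup>2" by simp
      then have "2 * m * (M * \<bar>X t\<bar> * \<bar>Y t\<bar>) \<le> M\<^sup>2 * (X t)\<^sup>2 + m\<^sup>2 * (Y t)\<^sup>2"
        by (simp add: power2_diff power_mult_distrib algebra_simps)
      then show ?thesis using m(1) by (simp add: field_simps power2_eq_square)
    qed
    finally have 1: "- x t * X t * Y t \<le> M\<^sup>2 / (2 * m) * (X t)\<^sup>2 + m / 2 * (Y t)\<^sup>2" .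
    have 2: "- x t * (Y t)\<^sup>2 \<le> - m * (Y t)\<^sup>2"
      using b by (intro mult_right_mono) auto
    have 3: "\<gamma> * y t * (X t)\<^sup>2 \<le> \<gamma> * M * (X t)\<^sup>2"
      using b \<gamma> by (intro mult_right_mono mult_left_mono) auto
    have "- x t * X t * Y t - x t * (Y t)\<^sup>2 + \<gamma> * y t * (X t)\<^sup>2 \<le> C * (X t)\<^sup>2 - m / 2 * (Y t)\<^sup>2"
      using 1 2 3 unfolding C_def by (simp add: algebra_simps)
    then have "e * (- x t * X t * Y t - x t * (Y t)\<^sup>2 + \<gamma> * y t * (X t)\<^sup>2)
        \<le> e * (C * (X t)\<^sup>2 - m / 2 * (Y t)\<^sup>2)"
      using e by (intro mult_left_mono) auto
    also have "\<dots> = \<gamma> / 2 * (X t)\<^sup>2 - e * m / 2 * (Y t)\<^sup>2"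
      unfolding right_diff_distrib mult.assoc[symmetric] e(2) by simp
    finally have "W' t \<le> - (\<gamma> / 2 * (X t)\<^sup>2) - e * m / 2 * (Y t)\<^sup>2 + \<kappa> * d\<^sup>2"
      by (simp add: W'_def)
    also have "\<dots> \<le> - (\<kappa> * (X t)\<^sup>2) - \<kappa> * (Y t)\<^sup>2 + \<kappa> * d\<^sup>2"
      using \<kappa> by (intro add_mono diff_mono mult_right_mono le_imp_neg_le) auto
    also have "\<dots> \<le> 0"
    proof -
      have "d \<le> dist (u t) (xs, ys)" using far t by force
      then have "d\<^sup>2 \<le> (dist (u t) (xs, ys))\<^sup>2" using \<open>d > 0\<close> by (intro power_mono) auto
      also have "\<dots> = (X t)\<^sup>2 + (Y t)\<^sup>2"
        by (cases "u t") (simp add: dist_Pair_Pair dist_real_def X_def Y_def x_def y_def)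
      finally have "\<kappa> * d\<^sup>2 \<le> \<kappa> * ((X t)\<^sup>2 + (Y t)\<^sup>2)" using \<kappa> by (intro mult_left_mono) auto
      then show ?thesis by (simp add: algebra_simps)
    qed
    finally show ?thesis .
  qed
  have W_ge: "W t \<ge> \<kappa> * d\<^sup>2 * t - e * M\<^sup>2" if t: "t \<ge> 0" for t
  proof -
    have "\<bar>X t\<bar> \<le> M" "\<bar>Y t\<bar> \<le> M"
      using bounds[OF t] pos[OF t] m equilibrium_pos sum_eq_1 by (auto simp: X_def Y_def)
    then have "\<bar>X t * Y t\<bar> \<le> M\<^sup>2"
      using m by (simp add: abs_mult power2_eq_square mult_mono)
    then have "X t * Y t \<ge> - M\<^sup>2" by linarith
    then have "e * (X t * Y t) \<ge> e * (- M\<^sup>2)" using e by (intro mult_left_mono) auto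
    then show ?thesis
      using V_lower(3)[OF pos[OF t]] by (simp add: W_def v_def)
  qed
  \<comment> \<open>At this time the linear lower bound for \<open>W\<close> equals
    \<open>\<bar>W 0\<bar> + 1\<close>, which exceeds \<open>W 0\<close>.\<close>
  define T where "T = (\<bar>W 0\<bar> + e * M\<^sup>2 + 1) / (\<kappa> * d\<^sup>2)"
  have T: "T \<ge> 0" "\<kappa> * d\<^sup>2 * T = \<bar>W 0\<bar> + e * M\<^sup>2 + 1"
    using e \<kappa> \<open>d > 0\<close> by (auto simp: T_def)
  have "W T \<le> W 0"
    by (rule nonincreasing_on_interval[OF W' W'_le T(1)])
  then show False using W_ge[OF T(1)] T(2) by linarith
qed

lemma attractive: "attractive_on (plankton_field r \<gamma>) positive_quadrant (xs, ys)"
  unfolding attractive_on_def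
proof (intro allI impI tendstoI)
  fix u and e :: real
  assume u: "is_solution (plankton_field r \<gamma>) u" "u 0 \<in> positive_quadrant" and "e > 0"
  then obtain \<delta> where \<delta>: "\<delta> > 0" "\<And>u. is_solution (plankton_field r \<gamma>) u \<Longrightarrow>
      dist (u 0) (xs, ys) < \<delta> \<Longrightarrow> \<forall>t\<ge>0. dist (u t) (xs, ys) < e"
    using stable unfolding lyapunov_stable_def by meson
  obtain s where s: "s \<ge> 0" "dist (u s) (xs, ys) < \<delta>"
    using enters_every_ball[OF u \<delta>(1)] by blast
  \<comment> \<open>Stability is applied to the solution restarted at \<open>s\<close>, whose time
    argument is \<open>t - s\<close>.\<close>
  have "dist (u t) (xs, ys) < e" if "t \<ge> s" for t
    using \<delta>(2)[OF is_solution_shift[OF u(1) s(1)]] s(2) that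
    by (metis add.right_neutral add_diff_cancel_left' diff_ge_0_iff_ge le_add_diff_inverse)
  then show "\<forall>\<^sub>F t in at_top. dist (u t) (xs, ys) < e"
    by (auto simp: eventually_at_top_linorder)
qed

end

theorem theorem2:
  fixes r \<gamma> :: real
  assumes "r > 0" and "\<gamma> > 0" and "\<gamma> > r"
  shows "globally_asymptotically_stable_on (plankton_field r \<gamma>) positive_quadrant
           (r / \<gamma>, 1 - r / \<gamma>)"
proof -
  interpret plankton r \<gamma> using assms by unfold_locales
  have "equilibrium (plankton_field r \<gamma>) (xs, ys)"
    using assms by (simp add: equilibrium_def plankton_field_def xs_def ys_def zero_prod_def)
  then show ?thesis
    using open_positive_quadrant equilibrium_in_quadrant has_global_solution stable attractive
    unfolding globally_asymptotically_stable_on_def forward_complete_on_def xs_def ys_def by blast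
qed

end
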